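(* Let $G = (V_1 \cup V_2, E, \bm{w})$ be a (finite) weighted bipartite graph with edge weights $\bm{w} \in \mathbb{R}^{|E|}$, and let $M$ be a matching in $G$. If $M$ is Pareto-optimal, then $M$ is fractionally Pareto-optimal.
   Context: $G=(V_1\cup V_2,E,\bm{w})$ is a bipartite graph with every edge joining a vertex of $V_1$ to a vertex of $V_2$; the weight of edge $(i,j)$, $i\in V_1$, $j\in V_2$, is $w_{i,j}\in\mathbb{R}$. The graph need not be complete. A matching $M\subseteq E$ is a nonempty subset of edges with no common vertices; $V_1(M)\subseteq V_1$ is the set of vertices of $V_1$ matched in $M$, and for $i\in V_1(M)$, $M(i)\in V_2$ is the vertex matched to $i$. Let $\mathcal{M}$ be the set of all matchings in $G$. The payoff vector $\bm{u}^M\in\mathbb{R}^{|V_1|}$ of a matching $M$ is defined by $u_i^M = w_{i,M(i)}$ if $i\in V_1(M)$ and $u_i^M=0$ otherwise. For vectors $\bm{u},\bm{u}'$, write $\bm{u}\succ\bm{u}'$ ($\bm{u}$ Pareto-dominates $\bm{u}'$) if $u_i\ge u_i'$ for all $i$ and $u_i>u_i'$ for some $i$. $M\in\mathcal{M}$ is Pareto-optimal if there is no $M'\in\mathcal{M}$ with $\bm{u}^{M'}\succ\bm{u}^M$. $M\in\mathcal{M}$ is fractionally Pareto-optimal if there is no vector $\bm{\alpha}\in\mathbb{R}^{|\mathcal{M}|}_{+}$ (nonnegative entries) with $\bm{1}^\top\bm{\alpha}=1$ and $\sum_{M'\in\mathcal{M}}\alpha_{M'}\bm{u}^{M'}\succ\bm{u}^M$.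 *)

theory Defs
  imports Complex_Main
begin

text \<open>
  The two sides of the graph live in separate types, so they are disjoint by construction.
  An edge joining \<open>i\<close> in \<open>V1\<close> to \<open>j\<close> in \<open>V2\<close> is the pair \<open>(i, j)\<close>; the weight function
  matters only on the edge set.
\<close>

definition bipartite_graph :: "'a set \<Rightarrow> 'b set \<Rightarrow> ('a \<times> 'b) set \<Rightarrow> bool" where
  "bipartite_graph V1 V2 E \<longleftrightarrow> finite V1 \<and> finite V2 \<and> E \<subseteq> V1 \<times> V2"

text \<open>Matchings are nonempty by convention.\<close>

definition matchings :: "('a \<times> 'b) set \<Rightarrow> ('a \<times> 'b) set set" where
  "matchings E = {M. M \<subseteq> E \<and> M \<noteq> {} \<and>
     (\<forall>e\<in>M. \<forall>e'\<in>M. e \<noteq> e' \<longrightarrow> fst e \<noteq> fst e' \<and> snd e \<noteq> snd e')}"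

definition matched1 :: "('a \<times> 'b) set \<Rightarrow> 'a set" where
  "matched1 M = fst ` M"

definition partner :: "('a \<times> 'b) set \<Rightarrow> 'a \<Rightarrow> 'b" where
  "partner M i = (THE j. (i, j) \<in> M)"

definition payoff :: "('a \<times> 'b \<Rightarrow> real) \<Rightarrow> ('a \<times> 'b) set \<Rightarrow> 'a \<Rightarrow> real" where
  "payoff w M i = (if i \<in> matched1 M then w (i, partner M i) else 0)"

text \<open>Vectors indexed by \<open>V1\<close> are functions of which only the values on \<open>V1\<close> are compared.\<close>

definition pareto_dominates :: "'a set \<Rightarrow> ('a \<Rightarrow> real) \<Rightarrow> ('a \<Rightarrow> real) \<Rightarrow> bool" where
  "pareto_dominates V1 u u' \<longleftrightarrow> (\<forall>i\<in>V1. u i \<ge> u' i) \<and> (\<exists>i\<in>V1. u i > u' i)"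

text \<open>The two optimality notions are meant for \<open>M \<in> matchings E\<close>.\<close>

definition pareto_optimal ::
  "'a set \<Rightarrow> ('a \<times> 'b) set \<Rightarrow> ('a \<times> 'b \<Rightarrow> real) \<Rightarrow> ('a \<times> 'b) set \<Rightarrow> bool" where
  "pareto_optimal V1 E w M \<longleftrightarrow>
     \<not> (\<exists>M'\<in>matchings E. pareto_dominates V1 (payoff w M') (payoff w M))"

definition fractionally_pareto_optimal ::
  "'a set \<Rightarrow> ('a \<times> 'b) set \<Rightarrow> ('a \<times> 'b \<Rightarrow> real) \<Rightarrow> ('a \<times> 'b) set \<Rightarrow> bool" where
  "fractionally_pareto_optimal V1 E w M \<longleftrightarrow>
     \<not> (\<exists>\<alpha> :: ('a \<times> 'b) set \<Rightarrow> real.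
          (\<forall>M'\<in>matchings E. \<alpha> M' \<ge> 0) \<and> (\<Sum>M'\<in>matchings E. \<alpha> M') = 1 \<and>
          pareto_dominates V1 (\<lambda>i. \<Sum>M'\<in>matchings E. \<alpha> M' * payoff w M' i) (payoff w M))"

end

theory Submission
  imports Defs "HOL-Library.Transitive_Closure_Table"
begin

text \<open>Suppose a lottery over matchings dominates the Pareto-optimal \<open>M\<close>, and let \<open>D\<close> be the set of
  agents who strictly gain over \<open>M\<close> in some matching of its support. An agent envies another whose
  object is at least as good as its own (strictly better, for a distinguished agent \<open>i\<close>). No envy
  chain from \<open>i\<close> returns to \<open>i\<close> or ends at a free object or at opting out, as trading along it would
  improve on \<open>M\<close>. Choose \<open>i \<in> D\<close> reaching the fewest other agents, say the set \<open>T\<close>. Then \<open>T\<close> is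
  disjoint from \<open>D\<close>, so its members are indifferent between \<open>M\<close> and every support matching. Hence in
  a support matching favouring \<open>i\<close>, all \<open>card T + 1\<close> agents in \<open>T\<close> and \<open>i\<close> receive distinct objects
  among the \<open>card T\<close> objects that \<open>M\<close> gives to \<open>T\<close>.\<close>

text \<open>\<open>None\<close> is the choice of opting out, so that it can be ranked against
  objects.\<close>

definition mate :: "('a \<times> 'b) set \<Rightarrow> 'a \<Rightarrow> 'b option" where
  "mate M i = (if i \<in> matched1 M then Some (partner M i) else None)"

fun val :: "('a \<times> 'b \<Rightarrow> real) \<Rightarrow> 'a \<Rightarrow> 'b option \<Rightarrow> real" where
  "val w i None = 0"
| "val w i (Some j) = w (i, j)"

text \<open>Objects are exclusive, whereas any number of agents may opt out.\<close>

definition inj_some_on :: "('a \<Rightarrow> 'b option) \<Rightarrow> 'a set \<Rightarrow> bool" where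
  "inj_some_on f A \<longleftrightarrow> (\<forall>i\<in>A. \<forall>i'\<in>A. \<forall>j. f i = Some j \<longrightarrow> f i' = Some j \<longrightarrow> i = i')"

lemma payoff_eq_val: "payoff w M i = val w i (mate M i)"
  by (simp add: payoff_def mate_def)

lemma mate_eq_Some_iff:
  assumes "M \<in> matchings E"
  shows "mate M i = Some j \<longleftrightarrow> (i, j) \<in> M"
proof -
  have uniq: "j' = j" if "(i, j) \<in> M" "(i, j') \<in> M" for j j'
    using assms that unfolding matchings_def by fastforce
  have "partner M i = j" if "(i, j) \<in> M" for j
    unfolding partner_def using that uniq by blast
  then show ?thesis
    unfolding mate_def matched1_def by (force simp: image_iff)
qed

lemma mate_edge: "M \<in> matchings E \<Longrightarrow> mate M i = Some j \<Longrightarrow> (i, j) \<in> E"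
  by (simp add: mate_eq_Some_iff) (auto simp: matchings_def)

lemma inj_some_mate: "M \<in> matchings E \<Longrightarrow> inj_some_on (mate M) A"
  unfolding inj_some_on_def by (simp add: mate_eq_Some_iff) (fastforce simp: matchings_def)

lemma matching_of_assignment:
  assumes "\<And>i j. g i = Some j \<Longrightarrow> (i, j) \<in> E" "inj_some_on g UNIV" "g i0 \<noteq> None"
  obtains N where "N \<in> matchings E" "mate N = g"
proof
  let ?N = "{(i, j). g i = Some j}"
  have inj: "i = i'" if "g i = Some j" "g i' = Some j" for i i' j
    using assms(2) that unfolding inj_some_on_def by blast
  have "fst e \<noteq> fst e' \<and> snd e \<noteq> snd e'" if "e \<in> ?N" "e' \<in> ?N" "e \<noteq> e'" for e e'
    using that inj by (cases e; cases e') force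
  moreover have "?N \<subseteq> E"
    using assms(1) by blast
  moreover have "?N \<noteq> {}"
    using assms(3) by blast
  ultimately show N: "?N \<in> matchings E"
    unfolding matchings_def by blast
  show "mate ?N = g"
  proof
    show "mate ?N i = g i" for i
      using mate_eq_Some_iff[OF N, of i] by (cases "g i"; cases "mate ?N i") auto
  qed
qed

lemma finite_matchings: "finite E \<Longrightarrow> finite (matchings E)"
  by (rule finite_subset[of _ "Pow E"]) (auto simp: matchings_def)

text \<open>Each agent of the chain takes over the object of its successor, and the last one takes \<open>x\<close>.
  The object of the first agent is released, so \<open>x\<close> may be that object.\<close>

lemma chain_reassignment:
  assumes "l \<noteq> []" "distinct l" "successively (\<lambda>a b. P a (f b)) l" "P (last l) x"
    and "\<And>k. k \<noteq> hd l \<Longrightarrow> P k (f k)"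
    and "\<And>k j. k \<noteq> hd l \<Longrightarrow> x = Some j \<Longrightarrow> f k \<noteq> Some j"
    and "inj_some_on f (- {hd l})"
  shows "\<exists>g. (\<forall>k. P k (g k)) \<and> inj_some_on g UNIV"
  using assms
proof (induction l arbitrary: f rule: induct_list012)
  case 1
  then show ?case by simp
next
  case (2 i)
  then have "(\<forall>k. P k ((f(i := x)) k)) \<and> inj_some_on (f(i := x)) UNIV"
    unfolding inj_some_on_def by auto
  then show ?case by blast
next
  case (3 i i' l)
  \<comment> \<open>Under \<open>?f\<close> the object of \<open>i'\<close> is held twice. This is
    harmless: injectivity is only demanded off the head of the list, which is now
    \<open>i'\<close>.\<close>
  let ?f = "f(i := f i')"
  show ?case
  proof (rule "3.IH"(2)[of ?f])
    have "successively (\<lambda>a b. P a (f b)) (i' # l)"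
      using "3.prems"(3) by simp
    then show "successively (\<lambda>a b. P a (?f b)) (i' # l)"
      by (rule successively_mono) (use "3.prems"(2) in auto)
    show "inj_some_on ?f (- {hd (i' # l)})"
      using "3.prems"(2,7) unfolding inj_some_on_def by auto
  qed (use "3.prems" in auto)
qed

text \<open>Cutting loops out of a chain leaves each agent on it once, as trading along it
  requires.\<close>

lemma rtranclp_imp_distinct_successively:
  assumes "r\<^sup>*\<^sup>* a b"
  obtains l where "l \<noteq> []" "hd l = a" "last l = b" "distinct l" "successively r l"
proof -
  obtain xs where "rtrancl_path r a xs b"
    using assms by (auto simp: rtranclp_eq_rtrancl_path)
  then obtain ys where ys: "rtrancl_path r a ys b" "distinct (a # ys)"
    by (rule rtrancl_path_distinct)
  from ys(1) have "last (a # ys) = b \<and> successively r (a # ys)"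
    by induction (auto simp: successively_Cons)
  with ys(2) show thesis
    by (intro that[of "a # ys"]) auto
qed

text \<open>The strict clause for \<open>i0\<close> turns a reassignment acceptable to all into one
  dominating \<open>M\<close>.\<close>

definition acceptable ::
  "('a \<times> 'b) set \<Rightarrow> ('a \<times> 'b \<Rightarrow> real) \<Rightarrow> ('a \<times> 'b) set \<Rightarrow> 'a \<Rightarrow> 'a \<Rightarrow> 'b option \<Rightarrow> bool" where
  "acceptable E w M i0 k x \<longleftrightarrow> (\<forall>j. x = Some j \<longrightarrow> (k, j) \<in> E) \<and>
     payoff w M k \<le> val w k x \<and> (k = i0 \<longrightarrow> payoff w M k < val w k x)"

definition envies ::
  "('a \<times> 'b) set \<Rightarrow> ('a \<times> 'b \<Rightarrow> real) \<Rightarrow> ('a \<times> 'b) set \<Rightarrow> 'a \<Rightarrow> 'a \<Rightarrow> 'a \<Rightarrow> bool" where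
  "envies E w M i0 a b \<longleftrightarrow> acceptable E w M i0 a (mate M b)"

text \<open>Reassigning along an envy chain can only fail to produce a dominating matching when it
  produces the empty one, which has payoff vector zero.\<close>

lemma improving_chain_imp_not_pareto_optimal:
  assumes M: "M \<in> matchings E" and i0: "i0 \<in> V1"
    and zero: "\<not> pareto_dominates V1 (\<lambda>_. 0) (payoff w M)"
    and reach: "(envies E w M i0)\<^sup>*\<^sup>* i0 s" and x: "acceptable E w M i0 s x"
    and free: "\<And>k j. k \<noteq> i0 \<Longrightarrow> x = Some j \<Longrightarrow> mate M k \<noteq> Some j"
  shows "\<not> pareto_optimal V1 E w M"
proof -
  obtain l where l: "l \<noteq> []" "hd l = i0" "last l = s" "distinct l"
    "successively (envies E w M i0) l"
    using reach by (rule rtranclp_imp_distinct_successively)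
  have "\<exists>g. (\<forall>k. acceptable E w M i0 k (g k)) \<and> inj_some_on g UNIV"
  proof (rule chain_reassignment[where l = l and f = "mate M" and x = x])
    show "acceptable E w M i0 k (mate M k)" if "k \<noteq> hd l" for k
      using that l(2) mate_edge[OF M] by (auto simp: acceptable_def payoff_eq_val)
  qed (use l x free inj_some_mate[OF M] in \<open>auto simp: envies_def[abs_def]\<close>)
  then obtain g where g: "\<And>k. acceptable E w M i0 k (g k)" "inj_some_on g UNIV"
    by blast
  have dom: "pareto_dominates V1 (\<lambda>k. val w k (g k)) (payoff w M)"
    using g(1) i0 unfolding acceptable_def pareto_dominates_def by blast
  obtain k where "g k \<noteq> None"
  proof (rule ccontr)
    assume "\<not> thesis"
    with that have "g k = None" for k
      by blast
    with dom zero show False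
      by simp
  qed
  moreover have "(i, j) \<in> E" if "g i = Some j" for i j
    using g(1) that unfolding acceptable_def by blast
  ultimately obtain N where "N \<in> matchings E" "mate N = g"
    using matching_of_assignment[of g E k] g(2) by blast
  with dom have "pareto_dominates V1 (payoff w N) (payoff w M)"
    by (simp add: payoff_eq_val[abs_def])
  with \<open>N \<in> matchings E\<close> show ?thesis
    unfolding pareto_optimal_def by blast
qed

text \<open>The terms \<open>\<alpha> a * (c - y a)\<close> are nonnegative and sum to
  \<open>c\<close> minus the average; if that is zero, every term vanishes.\<close>

lemma convex_combination_le:
  fixes \<alpha> y :: "'c \<Rightarrow> real"
  assumes "finite A" "\<And>a. a \<in> A \<Longrightarrow> 0 \<le> \<alpha> a" "sum \<alpha> A = 1"
    and "\<And>a. a \<in> A \<Longrightarrow> 0 < \<alpha> a \<Longrightarrow> y a \<le> c"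
  shows "(\<Sum>a\<in>A. \<alpha> a * y a) \<le> c"
    and "c \<le> (\<Sum>a\<in>A. \<alpha> a * y a) \<Longrightarrow> a \<in> A \<Longrightarrow> 0 < \<alpha> a \<Longrightarrow> y a = c"
proof -
  have nonneg: "0 \<le> \<alpha> a * (c - y a)" if "a \<in> A" for a
    using assms(2,4)[OF that] by (cases "\<alpha> a = 0") auto
  have eq: "(\<Sum>a\<in>A. \<alpha> a * (c - y a)) = c - (\<Sum>a\<in>A. \<alpha> a * y a)"
    using assms(3) by (simp add: right_diff_distrib sum_subtractf flip: sum_distrib_right)
  show "(\<Sum>a\<in>A. \<alpha> a * y a) \<le> c"
    using sum_nonneg[of A "\<lambda>a. \<alpha> a * (c - y a)"] nonneg eq by simp
  assume "c \<le> (\<Sum>a\<in>A. \<alpha> a * y a)" "a \<in> A" "0 < \<alpha> a"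
  moreover from this have "(\<Sum>a\<in>A. \<alpha> a * (c - y a)) = 0"
    using sum_nonneg[of A "\<lambda>a. \<alpha> a * (c - y a)"] nonneg eq by simp
  ultimately have "\<alpha> a * (c - y a) = 0"
    using sum_nonneg_eq_0_iff[OF assms(1) nonneg] by force
  then show "y a = c"
    using \<open>0 < \<alpha> a\<close> by simp
qed

theorem theorem12:
  fixes V1 :: "'a set" and V2 :: "'b set" and E :: "('a \<times> 'b) set"
    and w :: "'a \<times> 'b \<Rightarrow> real" and M :: "('a \<times> 'b) set"
  assumes "bipartite_graph V1 V2 E"
    and "M \<in> matchings E"
    and "pareto_optimal V1 E w M"
  shows "fractionally_pareto_optimal V1 E w M"
proof (rule ccontr)
  assume "\<not> fractionally_pareto_optimal V1 E w M"
  then obtain \<alpha> :: "('a \<times> 'b) set \<Rightarrow> real"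
    where \<alpha>: "\<And>N. N \<in> matchings E \<Longrightarrow> 0 \<le> \<alpha> N" "sum \<alpha> (matchings E) = 1"
      and dom: "pareto_dominates V1 (\<lambda>i. \<Sum>N\<in>matchings E. \<alpha> N * payoff w N i) (payoff w M)"
    unfolding fractionally_pareto_optimal_def by blast
  have V1: "finite V1" and E: "E \<subseteq> V1 \<times> V2" and fin: "finite (matchings E)"
    using assms(1) finite_matchings[of E] finite_subset[of E "V1 \<times> V2"]
    by (auto simp: bipartite_graph_def)
  define supp where "supp = {N \<in> matchings E. 0 < \<alpha> N}"
  have suppD: "N \<in> matchings E" if "N \<in> supp" for N
    using that by (simp add: supp_def)
  define D where "D = {i \<in> V1. \<exists>N\<in>supp. payoff w M i < payoff w N i}"
  \<comment> \<open>Such an agent never gains in the support, yet does not lose on average, so it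
    never loses either.\<close>
  have tight: "payoff w N i = payoff w M i" if "i \<in> V1" "i \<notin> D" "N \<in> supp" for i N
    using that dom convex_combination_le(2)[OF fin \<alpha>, of "\<lambda>N. payoff w N i" "payoff w M i" N]
    unfolding supp_def D_def pareto_dominates_def by (force simp: not_less)
  have "D \<noteq> {}"
  proof -
    obtain i where i: "i \<in> V1" "payoff w M i < (\<Sum>N\<in>matchings E. \<alpha> N * payoff w N i)"
      using dom unfolding pareto_dominates_def by blast
    then have "i \<in> D"
      using convex_combination_le(1)[OF fin \<alpha>, of "\<lambda>N. payoff w N i" "payoff w M i"]
      unfolding supp_def D_def by (force simp: not_less)
    then show ?thesis by blast
  qed
  have not_dom: False if "N \<in> matchings E" "pareto_dominates V1 (payoff w N) (payoff w M)" for N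
    using assms(3) that unfolding pareto_optimal_def by blast
  have V1_mate: "k \<in> V1" if "mate M k \<noteq> None" for k
    using that mate_edge[OF assms(2)] E by fastforce

  show False
  \<comment> \<open>Zero payoffs may dominate a Pareto-optimal \<open>M\<close>, as the empty set is
    not a matching.\<close>
  proof (cases "pareto_dominates V1 (\<lambda>_. 0) (payoff w M)")
    case True
    text \<open>Here all edges have negative weight, since a single edge of nonnegative weight would
      dominate \<open>M\<close>, and likewise one edge of \<open>M\<close> alone carries the payoff of \<open>M\<close>.\<close>
    obtain i1 where i1: "i1 \<in> V1" "payoff w M i1 < 0"
      using True unfolding pareto_dominates_def by blast
    have u: "payoff w M k \<le> 0" if "k \<in> V1" for k
      using True that unfolding pareto_dominates_def by blast
    have single: "payoff w {(i, j)} k = (if k = i then w (i, j) else 0)" for i j k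
      by (auto simp: payoff_def matched1_def partner_def)
    have single_in: "{(i, j)} \<in> matchings E" if "(i, j) \<in> E" for i j
      using that by (auto simp: matchings_def)
    have neg: "w (i, j) < 0" if "(i, j) \<in> E" for i j
    proof (rule ccontr)
      assume "\<not> w (i, j) < 0"
      then have "0 \<le> payoff w {(i, j)} k" for k
        by (simp add: single)
      then have "pareto_dominates V1 (payoff w {(i, j)}) (payoff w M)"
        using u i1 unfolding pareto_dominates_def by (meson order_trans less_le_trans)
      then show False
        using not_dom single_in[OF that] by blast
    qed
    have nonpos: "payoff w N k \<le> 0" if "N \<in> matchings E" for N k
      using neg mate_edge[OF that, of k] unfolding payoff_eq_val
      by (cases "mate N k") (auto intro: less_imp_le)
    obtain j1 where j1: "mate M i1 = Some j1"
      using i1 by (cases "mate M i1") (auto simp: payoff_eq_val)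
    have zero: "payoff w M k = 0" if "k \<in> V1" "k \<noteq> i1" for k
    proof (rule ccontr)
      assume "payoff w M k \<noteq> 0"
      then have "pareto_dominates V1 (payoff w {(i1, j1)}) (payoff w M)"
        using u that j1 unfolding pareto_dominates_def single
        by (force simp: payoff_eq_val order_less_le)
      then show False
        using not_dom single_in mate_edge[OF assms(2) j1] by blast
    qed
    \<comment> \<open>All others already have payoff 0, the most that any matching gives. So only
      \<open>i1\<close> can gain, and a support matching where it does dominates
      \<open>M\<close>.\<close>
    have "D \<subseteq> {i1}"
      using zero nonpos suppD unfolding D_def by auto (metis leD)
    then obtain N where N: "N \<in> supp" "payoff w M i1 < payoff w N i1"
      using \<open>D \<noteq> {}\<close> unfolding D_def by blast
    have "payoff w M k \<le> payoff w N k" if "k \<in> V1" for k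
      using tight[OF that _ N(1)] N(2) \<open>D \<subseteq> {i1}\<close> by (cases "k = i1") force+
    then have "pareto_dominates V1 (payoff w N) (payoff w M)"
      using N i1 unfolding pareto_dominates_def by blast
    then show False
      using not_dom suppD[OF N(1)] by blast
  next
    case False
    define T where "T i = {s. (envies E w M i)\<^sup>*\<^sup>* i s} - {i}" for i
    \<comment> \<open>If \<open>x\<close> were free, opting out or the object of \<open>i\<close>,
      the chain from \<open>i\<close> to \<open>s\<close> would improve on \<open>M\<close>. So
      \<open>x\<close> has another holder, whom \<open>s\<close> envies.\<close>
    have taken: "\<exists>k. k \<in> T i \<and> mate M k \<noteq> None \<and> x = mate M k"
      if i: "i \<in> D" and s: "s = i \<or> s \<in> T i" and x: "acceptable E w M i s x" for i s x
    proof -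
      have reach: "(envies E w M i)\<^sup>*\<^sup>* i s"
        using s unfolding T_def by auto
      obtain k j where k: "k \<noteq> i" "x = Some j" "mate M k = Some j"
        using improving_chain_imp_not_pareto_optimal[OF assms(2) _ False reach x]
          assms(3) i unfolding D_def by auto
      then have "envies E w M i s k"
        using x by (simp add: envies_def)
      then show ?thesis
        using k reach unfolding T_def by (auto intro: rtranclp.rtrancl_into_rtrancl)
    qed
    \<comment> \<open>The type may contain agents outside \<open>V1\<close>, but reached agents hold
      objects in \<open>M\<close>.\<close>
    have T_V1: "T i \<subseteq> V1" if "i \<in> D" for i
    proof
      fix s assume "s \<in> T i"
      then have "(envies E w M i)\<^sup>*\<^sup>* i s" "s \<noteq> i"
        by (auto simp: T_def)
      then obtain s' where s': "(envies E w M i)\<^sup>*\<^sup>* i s'" "envies E w M i s' s"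
        by (metis rtranclp.cases)
      then have "s' = i \<or> s' \<in> T i" "acceptable E w M i s' (mate M s)"
        by (auto simp: T_def envies_def)
      then show "s \<in> V1"
        using taken[OF that] V1_mate by metis
    qed
    obtain i where i: "i \<in> D" and min: "\<And>s. s \<in> D \<Longrightarrow> card (T i) \<le> card (T s)"
      using \<open>D \<noteq> {}\<close> arg_min_natI[of "\<lambda>i. i \<in> D" _ "\<lambda>i. card (T i)"]
        arg_min_nat_le[of "\<lambda>i. i \<in> D" _ "\<lambda>i. card (T i)"] by blast
    have finT: "finite (T i)"
      using T_V1[OF i] V1 by (rule finite_subset)
    have "T i \<inter> D = {}"
    proof (rule ccontr)
      assume "T i \<inter> D \<noteq> {}"
      then obtain s where s: "s \<in> T i" "s \<in> D" by blast
      \<comment> \<open>For agents other than \<open>i\<close>, envy with \<open>s\<close>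
        distinguished implies envy with \<open>i\<close> distinguished, and such chains never reach
        \<open>i\<close>. Thus \<open>T s\<close> lies in \<open>T i\<close>, properly since it
        omits \<open>s\<close>.\<close>
      have "t \<in> T i" if "(envies E w M s)\<^sup>*\<^sup>* s t" for t
        using that
      proof induction
        case base
        show ?case by (rule s(1))
      next
        case (step a b)
        have "a \<noteq> i"
          using step.IH by (auto simp: T_def)
        with step.hyps have acc: "acceptable E w M i a (mate M b)"
          by (auto simp: envies_def acceptable_def)
        then obtain k where k: "k \<in> T i" "mate M k \<noteq> None" "mate M b = mate M k"
          using taken[OF i _ acc] step.IH by blast
        then have "b = k"
          using inj_some_mate[OF assms(2), of UNIV] unfolding inj_some_on_def by auto
        with k(1) show ?case by simp
      qed
      then have "T s \<subset> T i"
        using s(1) unfolding T_def by blast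
      then have "card (T s) < card (T i)"
        by (rule psubset_card_mono[OF finT])
      then show False
        using min[OF s(2)] by simp
    qed
    obtain N where N: "N \<in> supp" "payoff w M i < payoff w N i"
      using i unfolding D_def by blast
    have "payoff w N s = payoff w M s" if "s \<in> T i" for s
      using tight[OF _ _ N(1)] T_V1[OF i] \<open>T i \<inter> D = {}\<close> that by blast
    then have N_acc: "acceptable E w M i s (mate N s)" if "s = i \<or> s \<in> T i" for s
      using that N(2) mate_edge[OF suppD[OF N(1)]]
      unfolding acceptable_def payoff_eq_val[symmetric] by (metis order_refl less_imp_le)
    have N_taken: "mate N s \<in> mate M ` T i" "mate N s \<noteq> None" if "s = i \<or> s \<in> T i" for s
      using taken[OF i that N_acc[OF that]] by auto
    \<comment> \<open>Agents could coincide at \<open>None\<close>, so this relies on all of them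
      being matched in \<open>N\<close>.\<close>
    have "inj_on (mate N) (insert i (T i))"
    proof (rule inj_onI)
      fix s t assume "s \<in> insert i (T i)" "mate N s = mate N t"
      then show "s = t"
        using N_taken(2)[of s] inj_some_mate[OF suppD[OF N(1)], of UNIV]
        unfolding inj_some_on_def by auto
    qed
    moreover have "mate N ` insert i (T i) \<subseteq> mate M ` T i"
      using N_taken(1) by auto
    ultimately have "card (insert i (T i)) \<le> card (mate M ` T i)"
      using finT by (intro card_inj_on_le) auto
    also have "\<dots> \<le> card (T i)"
      using finT by (rule card_image_le)
    finally have "card (insert i (T i)) \<le> card (T i)" .
    moreover have "i \<notin> T i"
      by (simp add: T_def)
    ultimately show False
      using finT by simp
  qed
qed

end
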